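(* Let $\mu$ be the Laba–Wang measure on $\mathbb{R}^2$ with $d=2$ and $\alpha=1$ (defined in the context). For $R\ge1$ let $f_R$ be the indicator function of a ball of radius $R^{-1}$ centered at a point of $\operatorname{supp}\mu$, and let $g_R=(f_R\mu)*\psi_{R^{-1}}$. Then there does not exist $\eta\in(0,1)$, independent of $R$, such that $g_R$ can be $L^2$-approximated with accuracy $\eta$ by a trigonometric polynomial of degree $o(R^2)$. That is, there do not exist $\eta\in(0,1)$ and trigonometric polynomials $P_R$ of degree at most $k(R)$, with $k(R)/R^2\to0$ as $R\to\infty$, such that $$\|g_R-P_R\|_{L^2([0,1]^2)}\le\eta\,\|g_R\|_{L^2([0,1]^2)}$$ for all sufficiently large $R$.
   Context: Fix a nonnegative $\psi\in C_c^\infty(\mathbb{R}^2)$ with $\int\psi=1$ and let $\psi_\delta(x)=\delta^{-2}\psi(x/\delta)$; $f\mu$ is the measure $f\,d\mu$. A trigonometric polynomial of degree at most $k$ is a function $P(x)=\sum_{i=1}^k c_i e^{2\pi i x\cdot\xi_i}$ with $c_i\in\mathbb{C}$ and $\xi_i\in\mathbb{R}^2$ (degree counts the number of frequencies). Laba–Wang measure ($d=2$, $\alpha=1$): a probability measure $\mu$ supported on a subset of $[0,1]^2$ of Hausdorff dimension $1$ (whose existence is a theorem of Laba and Wang) such that, with $\widehat{\nu}(\xi)=\int e^{-2\pi i x\cdot\xi}\,d\nu(x)$: (a) for every $0<\gamma<1$ there is $C_1(\gamma)$ with $\mu(B(x,r))\le C_1(\gamma)r^\gamma$ for all $x\in\mathbb{R}^2$,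 $r>0$; (b) for every $\beta<1/2$ there is $C_2(\beta)>0$ with $|\widehat\mu(\xi)|\le C_2(\beta)(1+|\xi|)^{-\beta}$ for all $\xi\in\mathbb{R}^2$; (c) for every $\epsilon>0$ there is $C_\epsilon>0$ with $\mu(B(x,r))\ge C_\epsilon r^{1+\epsilon}$ for all $x\in\operatorname{supp}\mu$, $0<r\le1$; (d) for every $q>4$ there is $C_3(q)$ with $\|\widehat{h\mu}\|_{L^q(\mathbb{R}^2)}\le C_3(q)\|h\|_{L^2(\mu)}$ for all $h\in L^2(\mu)$.
   Formalization: The formal theorem additionally assumes that the distance from the ball centres to the boundary of [0,1]^2 does not tend to 0 as R→∞; without this the claim fails, e.g. if supp μ touches x_1=0 there and ψ is supported in x_1<-2, then g_R=0 on the square. *)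

theory Defs
  imports "HOL-Probability.Probability"
begin

type_synonym plane = "real^2"

abbreviation unit_square :: "plane set" where
  "unit_square \<equiv> cbox 0 1"

(* The L^p norm of a function, as an extended nonnegative real: it is infinite exactly when
   |f|^p has infinite integral. *)
definition Lp_norm :: "real \<Rightarrow> 'a measure \<Rightarrow> ('a \<Rightarrow> 'b::real_normed_vector) \<Rightarrow> ennreal" where
  "Lp_norm p M f =
     (let I = (\<integral>\<^sup>+x. ennreal (norm (f x) powr p) \<partial>M)
      in if I = \<infinity> then \<infinity> else ennreal (enn2real I powr (1 / p)))"

definition topological_support :: "'a::topological_space measure \<Rightarrow> 'a set" where
  "topological_support M = {x. \<forall>U. open U \<and> x \<in> U \<longrightarrow> emeasure M U > 0}"


(* Countable covers by bounded sets; only s > 0 is used, so an empty set of the cover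
   contributes 0 powr s = 0. *)
definition hausdorff_premeasure :: "real \<Rightarrow> real \<Rightarrow> 'a::metric_space set \<Rightarrow> ennreal" where
  "hausdorff_premeasure \<delta> s E =
     (INF U \<in> {U :: nat \<Rightarrow> 'a set. E \<subseteq> (\<Union>i. U i) \<and> (\<forall>i. bounded (U i) \<and> diameter (U i) \<le> \<delta>)}.
        \<Sum>i. ennreal (diameter (U i) powr s))"

definition hausdorff_measure :: "real \<Rightarrow> 'a::metric_space set \<Rightarrow> ennreal" where
  "hausdorff_measure s E = (SUP \<delta>\<in>{0<..}. hausdorff_premeasure \<delta> s E)"

definition hausdorff_dim :: "'a::metric_space set \<Rightarrow> ennreal" where
  "hausdorff_dim E = Inf {ennreal s | s. s > 0 \<and> hausdorff_measure s E = 0}"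


fun times_cont_differentiable ::
    "nat \<Rightarrow> ('a::euclidean_space \<Rightarrow> 'b::real_normed_vector) \<Rightarrow> bool" where
  "times_cont_differentiable 0 f = continuous_on UNIV f"
| "times_cont_differentiable (Suc n) f =
     ((\<forall>x. f differentiable (at x)) \<and>
      (\<forall>b\<in>Basis. times_cont_differentiable n (\<lambda>x. frechet_derivative f (at x) b)))"

definition test_function :: "('a::euclidean_space \<Rightarrow> 'b::real_normed_vector) \<Rightarrow> bool" where
  "test_function f \<longleftrightarrow> (\<forall>n. times_cont_differentiable n f) \<and> compact (closure {x. f x \<noteq> 0})"

definition dilate :: "real \<Rightarrow> (plane \<Rightarrow> real) \<Rightarrow> plane \<Rightarrow> real" where
  "dilate \<delta> \<psi> x = \<psi> (x /\<^sub>R \<delta>) / \<delta>\<^sup>2"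

(* (f \<mu>) * \<phi>, the convolution of the measure f d\<mu> with the function \<phi>. *)
definition weighted_conv ::
    "(plane \<Rightarrow> real) \<Rightarrow> plane measure \<Rightarrow> (plane \<Rightarrow> real) \<Rightarrow> plane \<Rightarrow> real" where
  "weighted_conv f \<mu> \<phi> x = (LINT y|\<mu>. f y * \<phi> (x - y))"

(* The Fourier transform of the complex measure h d\<mu>; cis t = exp (i t). *)
definition weighted_fourier :: "(plane \<Rightarrow> complex) \<Rightarrow> plane measure \<Rightarrow> plane \<Rightarrow> complex" where
  "weighted_fourier h \<mu> \<xi> = (LINT x|\<mu>. h x * cis (- 2 * pi * (x \<bullet> \<xi>)))"

(* The degree counts the frequencies, which are arbitrary points of the plane. *)
definition trig_poly_degree_le :: "nat \<Rightarrow> (plane \<Rightarrow> complex) \<Rightarrow> bool" where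
  "trig_poly_degree_le k P \<longleftrightarrow>
     (\<exists>(c :: nat \<Rightarrow> complex) (\<xi> :: nat \<Rightarrow> plane).
        \<forall>x. P x = (\<Sum>i=1..k. c i * cis (2 * pi * (x \<bullet> \<xi> i))))"

definition Laba_Wang_measure :: "plane measure \<Rightarrow> bool" where
  "Laba_Wang_measure \<mu> \<longleftrightarrow>
     prob_space \<mu> \<and> sets \<mu> = sets borel \<and>
     (\<exists>E \<subseteq> unit_square. hausdorff_dim E = 1 \<and> (AE x in \<mu>. x \<in> E)) \<and>
     (\<forall>\<gamma>. 0 < \<gamma> \<and> \<gamma> < 1 \<longrightarrow>
        (\<exists>C. \<forall>x. \<forall>r>0. measure \<mu> (ball x r) \<le> C * r powr \<gamma>)) \<and>
     (\<forall>\<beta><1/2. \<exists>C>0. \<forall>\<xi>.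
        cmod (weighted_fourier (\<lambda>_. 1) \<mu> \<xi>) \<le> C * (1 + norm \<xi>) powr (- \<beta>)) \<and>
     (\<forall>\<epsilon>>0. \<exists>C>0. \<forall>x\<in>topological_support \<mu>. \<forall>r. 0 < r \<and> r \<le> 1 \<longrightarrow>
        measure \<mu> (ball x r) \<ge> C * r powr (1 + \<epsilon>)) \<and>
     (\<forall>q>4. \<exists>C::real. \<forall>h. h \<in> borel_measurable \<mu> \<and> Lp_norm 2 \<mu> h < \<infinity> \<longrightarrow>
        Lp_norm q lborel (weighted_fourier h \<mu>) \<le> ennreal C * Lp_norm 2 \<mu> h)"

(* A Laba-Wang measure may charge every neighbourhood of a point on the boundary of the square, and
   for balls centred there the non-approximability can fail: if \<mu> has a support point z with
   z $ 1 = 0 and \<psi> vanishes where x $ 1 > -2, then g_R vanishes on the whole square, so that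
   P_R = 0 is exact. Hence the centres must not converge to the boundary. The second lemma below
   shows that every such measure has admissible centres, e.g. a fixed interior support point. *)
lemma Laba_Wang_line_null:
  assumes "Laba_Wang_measure \<mu>"
  shows "emeasure \<mu> {x. x $ j = a} = 0"
proof -
  interpret prob_space \<mu> using assms by (simp add: Laba_Wang_measure_def)
  have sets [measurable_cong]: "sets \<mu> = sets borel" using assms by (simp add: Laba_Wang_measure_def)
  have "\<forall>\<beta><1/2. \<exists>C>0. \<forall>\<xi>. cmod (weighted_fourier (\<lambda>_. 1) \<mu> \<xi>) \<le> C * (1 + norm \<xi>) powr (- \<beta>)"
    using assms by (simp add: Laba_Wang_measure_def)
  from this[rule_format, of "1/4"] obtain C where C: "C > 0"
    "\<And>\<xi>. cmod (weighted_fourier (\<lambda>_. 1) \<mu> \<xi>) \<le> C * (1 + norm \<xi>) powr (- (1/4))"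
    by auto
  let ?L = "{x :: plane. x $ j = a}"
  have L [measurable]: "?L \<in> sets \<mu>" 
    unfolding sets by (intro borel_closed closed_Collect_eq continuous_intros)
  have bound: "prob ?L \<le> 1 / real N + C * (1 + real M) powr (- (1/4))" if N: "N > 0" for N M :: nat
  proof -
    define e :: "int \<Rightarrow> plane \<Rightarrow> complex"
      where "e = (\<lambda>d x. cis (- 2 * pi * of_int d * real M * (x $ j - a)))"
    define S where "S = (\<lambda>x. \<Sum>n<N. e (int n) x)"
    have [measurable]: "e d \<in> borel_measurable \<mu>" for d
    proof -
      have "continuous_on UNIV (e d)"
        unfolding e_def cis_conv_exp by (intro continuous_intros)
      then have "e d \<in> borel_measurable borel" by (rule borel_measurable_continuous_onI)
      then show ?thesis by (simp cong: measurable_cong_sets add: sets)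
    qed
    have inte: "integrable \<mu> (e d)" for d
      by (rule integrable_const_bound[where B=1]) (simp add: e_def, measurable)
    have Sq: "complex_of_real ((cmod (S x))\<^sup>2) = (\<Sum>m<N. \<Sum>n<N. e (int m - int n) x)" for x
    proof -
      have "complex_of_real ((cmod (S x))\<^sup>2) = S x * cnj (S x)"
        by (rule complex_norm_square)
      also have "\<dots> = (\<Sum>m<N. \<Sum>n<N. e (int m) x * cnj (e (int n) x))"
        by (simp add: S_def sum_product)
      also have "\<dots> = (\<Sum>m<N. \<Sum>n<N. e (int m - int n) x)"
        by (intro sum.cong refl) (simp add: e_def cis_cnj cis_mult algebra_simps)
      finally show ?thesis .
    qed
    have four: "cmod (LINT x|\<mu>. e d x) = cmod (weighted_fourier (\<lambda>_. 1) \<mu> (axis j (of_int d * real M)))" for d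
    proof -
      have "(LINT x|\<mu>. e d x) = (LINT x|\<mu>. cis (2 * pi * of_int d * real M * a) * (1 * cis (- 2 * pi * (x \<bullet> axis j (of_int d * real M)))))"
        by (intro Bochner_Integration.integral_cong refl)
           (simp add: e_def cis_mult inner_axis algebra_simps)
      also have "\<dots> = cis (2 * pi * of_int d * real M * a) * weighted_fourier (\<lambda>_. 1) \<mu> (axis j (of_int d * real M))"
        by (simp add: weighted_fourier_def)
      finally show ?thesis by (simp add: norm_mult)
    qed
    have eb: "cmod (LINT x|\<mu>. e d x) \<le> (if d = 0 then 1 else 0) + C * (1 + real M) powr (- (1/4))" for d
    proof (cases "d = 0")
      case True
      then have "(LINT x|\<mu>. e d x) = 1" by (simp add: e_def prob_space)
      with True C(1) show ?thesis by simp
    next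
      case False
      then have "1 \<le> \<bar>real_of_int d\<bar>" by linarith
      from mult_right_mono[OF this, of "real M"]
      have "real M \<le> norm (axis j (of_int d * real M) :: plane)"
        by (simp add: norm_eq_sqrt_inner inner_axis_axis abs_mult)
      then have "(1 + norm (axis j (of_int d * real M) :: plane)) powr (- (1/4)) \<le> (1 + real M) powr (- (1/4))"
        by (intro powr_mono2') auto
      with C(2)[of "axis j (of_int d * real M)"] C(1) False show ?thesis 
        unfolding four by (auto intro: order_trans mult_left_mono)
    qed
    have intS: "integrable \<mu> (\<lambda>x. (cmod (S x))\<^sup>2)"
    proof -
      have "integrable \<mu> (\<lambda>x. complex_of_real ((cmod (S x))\<^sup>2))"
        unfolding Sq by (intro Bochner_Integration.integrable_sum inte)
      then show ?thesis by (simp only: complex_of_real_integrable_eq)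
    qed
    have "real N ^ 2 * prob ?L = (LINT x|\<mu>. real N ^ 2 * indicator ?L x)"
      using L sets_eq_imp_space_eq[OF sets] by simp
    also have "\<dots> \<le> (LINT x|\<mu>. (cmod (S x))\<^sup>2)"
    proof (intro integral_mono intS)
      show "real N ^ 2 * indicator ?L x \<le> (cmod (S x))\<^sup>2" for x
        by (auto simp: indicator_def S_def e_def)
    qed (use L in \<open>auto intro!: integrable_real_indicator simp: emeasure_eq_measure\<close>)
    also have "\<dots> \<le> cmod (complex_of_real (LINT x|\<mu>. (cmod (S x))\<^sup>2))" by simp
    also have "complex_of_real (LINT x|\<mu>. (cmod (S x))\<^sup>2) = (LINT x|\<mu>. (\<Sum>m<N. \<Sum>n<N. e (int m - int n) x))"
      unfolding Sq[symmetric] by (rule integral_complex_of_real[symmetric])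
    also have "\<dots> = (\<Sum>m<N. \<Sum>n<N. (LINT x|\<mu>. e (int m - int n) x))"
      by (subst Bochner_Integration.integral_sum, intro Bochner_Integration.integrable_sum inte)
         (auto intro!: sum.cong Bochner_Integration.integral_sum inte)
    also have "cmod \<dots> \<le> (\<Sum>m<N. \<Sum>n<N. (if m = n then 1 else 0) + C * (1 + real M) powr (- (1/4)))"
      using eb by (intro sum_norm_le order_trans[OF norm_sum] sum_mono) (smt (verit) eb of_nat_eq_iff)
    also have "\<dots> = real N + real N ^ 2 * (C * (1 + real M) powr (- (1/4)))"
      by (simp add: sum.distrib power2_eq_square distrib_left)
    finally have "real N ^ 2 * prob ?L \<le> real N ^ 2 * (1 / real N + C * (1 + real M) powr (- (1/4)))"
      using N by (simp add: power2_eq_square algebra_simps)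
    then show ?thesis using N by simp
  qed
  have "(\<lambda>N. 1 / real N + C * (1 + real N) powr (- (1/4))) \<longlonglongrightarrow> 0 + C * 0"
    by (intro tendsto_intros tendsto_neg_powr lim_1_over_n filterlim_tendsto_add_at_top[OF tendsto_const] filterlim_real_sequentially) auto
  then have "(\<lambda>N. 1 / real N + C * (1 + real N) powr (- (1/4))) \<longlonglongrightarrow> 0" by simp
  then have "prob ?L \<le> 0"
    by (rule LIMSEQ_le_const) (use bound in \<open>auto intro!: exI[of _ 1]\<close>)
  then have "prob ?L = 0" by (simp add: measure_le_0_iff)
  then show ?thesis by (simp add: emeasure_eq_measure)
qed

lemma Laba_Wang_interior_support:
  assumes "Laba_Wang_measure \<mu>"
  shows "topological_support \<mu> \<inter> interior unit_square \<noteq> {}"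
proof
  assume empty: "topological_support \<mu> \<inter> interior unit_square = {}"
  interpret prob_space \<mu> using assms by (simp add: Laba_Wang_measure_def)
  have sets: "sets \<mu> = sets borel" using assms by (simp add: Laba_Wang_measure_def)
  have sq: "AE x in \<mu>. x \<in> unit_square" using assms by (auto simp: Laba_Wang_measure_def)
  let ?F = "{U. open U \<and> emeasure \<mu> U = 0}"
  obtain F' where F': "F' \<subseteq> ?F" "countable F'" "\<Union>F' = \<Union>?F"
    using Lindelof[of ?F] by blast
  have "box 0 1 \<subseteq> \<Union>?F" 
    using empty by (auto simp: interior_cbox topological_support_def disjoint_iff zero_less_iff_neq_zero)
  with F' have sub: "box 0 1 \<subseteq> \<Union>F'" by simp
  have "U \<in> null_sets \<mu>" if "U \<in> F'" for U
    using that F'(1) by (auto simp: null_sets_def sets)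
  then have "\<Union>F' \<in> null_sets \<mu>"
    using null_sets_UN'[OF F'(2), of "\<lambda>U. U" \<mu>] by simp
  then have "AE x in \<mu>. x \<notin> \<Union>F'" by (rule AE_not_in)
  moreover have "AE x in \<mu>. \<forall>j. x $ j \<noteq> a" for a
  proof -
    have "{x. x $ j = a} \<in> null_sets \<mu>" for j
      using Laba_Wang_line_null[OF assms] unfolding null_sets_def sets
      by (auto intro!: borel_closed closed_Collect_eq continuous_intros)
    from AE_not_in[OF this] show ?thesis by (subst AE_all_countable) auto
  qed
  note this[of 0] this[of 1]
  ultimately have "AE x in \<mu>. False"
    using sq
  proof eventually_elim
    case (elim x)
    then have "x \<in> box 0 1" by (auto simp: mem_box_cart order_less_le)
    with sub elim show ?case by auto
  qed
  then show False by simp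
qed

end

theory Submission
  imports Defs
begin

text \<open>
  A trigonometric polynomial with few frequencies cannot concentrate on a small ball. If a space \<open>V\<close>
  of functions is spanned by \<open>k\<close> of them and is translation invariant, let \<open>w\<close> be its Christoffel
  function on a ball \<open>D\<close> of radius \<open>r\<close> around the origin, so that \<open>F(y)\<^sup>2 \<le> w(y) \<parallel>F\<parallel>\<^sup>2\<close> in \<open>L\<^sup>2(D)\<close>
  and \<open>\<integral>w \<le> k\<close>. Applying this at every \<open>y \<in> D\<close> to the translate of \<open>F\<close> that takes the value \<open>F(x)\<close>
  at \<open>y\<close>, and integrating over \<open>y\<close>, gives \<open>|D| F(x)\<^sup>2 \<le> k \<integral>F\<^sup>2\<close>, the integral being over the
  ball of radius \<open>2r\<close> around \<open>x\<close>; the constant does not depend on the frequencies.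
  The function \<open>g\<^sub>R\<close> lives on a ball of area comparable to \<open>1/R\<^sup>2\<close>, which for infinitely many scales
  stays away from the boundary of the square. There a polynomial of degree \<open>o(R\<^sup>2)\<close> has only a
  vanishing proportion of its \<open>L\<^sup>2\<close> mass.
\<close>

section \<open>Real square-integrable functions on a measure space\<close>

text \<open>Measurability of \<open>f\<close> is asked for separately because integrability of its
  square says nothing about the measurability of its sign.\<close>

definition square_integrable :: "'a measure \<Rightarrow> ('a \<Rightarrow> real) \<Rightarrow> bool" where
  "square_integrable M f \<longleftrightarrow> f \<in> borel_measurable M \<and> integrable M (\<lambda>x. (f x)\<^sup>2)"

lemma square_integrable_mult:
  assumes "square_integrable M f" "square_integrable M g"
  shows "integrable M (\<lambda>x. f x * g x)"
proof (rule Bochner_Integration.integrable_bound)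
  show "integrable M (\<lambda>x. (f x)\<^sup>2 + (g x)\<^sup>2)"
    using assms by (simp add: square_integrable_def)
  show "(\<lambda>x. f x * g x) \<in> borel_measurable M"
    using assms by (auto simp: square_integrable_def)
  have "\<bar>a * b\<bar> \<le> a\<^sup>2 + b\<^sup>2" for a b :: real
    using sum_squares_bound[of "\<bar>a\<bar>" "\<bar>b\<bar>"] zero_le_power2[of a] zero_le_power2[of b]
    unfolding abs_mult power2_abs by linarith
  then show "AE x in M. norm (f x * g x) \<le> norm ((f x)\<^sup>2 + (g x)\<^sup>2)"
    by simp
qed

lemma square_integrable_zero: "square_integrable M (\<lambda>x. 0)"
  by (simp add: square_integrable_def)

lemma square_integrable_cmult:
  "square_integrable M f \<Longrightarrow> square_integrable M (\<lambda>x. c * f x)"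
  by (auto simp: square_integrable_def power_mult_distrib)

lemma square_integrable_add:
  assumes "square_integrable M f" "square_integrable M g"
  shows "square_integrable M (\<lambda>x. f x + g x)"
  using assms square_integrable_mult[OF assms]
  by (auto simp: square_integrable_def power2_sum mult.assoc)

lemma square_integrable_diff:
  assumes "square_integrable M f" "square_integrable M g"
  shows "square_integrable M (\<lambda>x. f x - g x)"
  using square_integrable_add[OF assms(1) square_integrable_cmult[OF assms(2), of "-1"]] by simp

lemma square_integrable_sum:
  "(\<And>i. i \<in> I \<Longrightarrow> square_integrable M (u i)) \<Longrightarrow> square_integrable M (\<lambda>x. \<Sum>i\<in>I. u i x)"
  by (induction I rule: infinite_finite_induct)
     (auto intro: square_integrable_zero square_integrable_add)

lemma square_integrable_AE_zero:
  assumes "square_integrable M f" "(LINT x|M. f x * f x) = 0"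
  shows "AE x in M. f x = 0"
  using assms integral_nonneg_eq_0_iff_AE[of M "\<lambda>x. (f x)\<^sup>2"]
  by (auto simp: square_integrable_def power2_eq_square)

section \<open>Orthogonalisation and the Christoffel function of a finite-dimensional space\<close>

text \<open>Gram-Schmidt without normalisation, by induction on the index set. The
  \<open>u i\<close> may be linearly dependent, so some \<open>e i\<close> may vanish almost
  everywhere. The members are functions rather than classes, so the expansion of \<open>u i\<close>
  holds at every point.\<close>

lemma orthogonal_family_exists:
  assumes "finite I" "\<And>i. i \<in> I \<Longrightarrow> square_integrable M (u i)"
  shows "\<exists>e a. (\<forall>i\<in>I. square_integrable M (e i)) \<and>
           (\<forall>i\<in>I. \<forall>j\<in>I. i \<noteq> j \<longrightarrow> (LINT x|M. e i x * e j x) = 0) \<and>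
           (\<forall>i\<in>I. \<forall>x. u i x = (\<Sum>j\<in>I. a i j * e j x))"
  using assms
proof (induction I rule: finite_induct)
  case empty
  show ?case by simp
next
  case (insert n I)
  have "\<exists>e a. (\<forall>i\<in>I. square_integrable M (e i)) \<and>
           (\<forall>i\<in>I. \<forall>j\<in>I. i \<noteq> j \<longrightarrow> (LINT x|M. e i x * e j x) = 0) \<and>
           (\<forall>i\<in>I. \<forall>x. u i x = (\<Sum>j\<in>I. a i j * e j x))"
    by (rule insert.IH) (simp add: insert.prems)
  then obtain e a where ih: "(\<forall>i\<in>I. square_integrable M (e i)) \<and>
           (\<forall>i\<in>I. \<forall>j\<in>I. i \<noteq> j \<longrightarrow> (LINT x|M. e i x * e j x) = 0) \<and>
           (\<forall>i\<in>I. \<forall>x. u i x = (\<Sum>j\<in>I. a i j * e j x))"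
    by (elim exE) (rule that)
  have e: "square_integrable M (e i)" if "i \<in> I" for i
    using ih[THEN conjunct1] that by (rule bspec)
  have orth: "(LINT x|M. e i x * e j x) = 0" if "i \<in> I" "j \<in> I" "i \<noteq> j" for i j
    using ih[THEN conjunct2, THEN conjunct1] that by blast
  have a: "u i x = (\<Sum>j\<in>I. a i j * e j x)" if "i \<in> I" for i x
    using ih[THEN conjunct2, THEN conjunct2, rule_format, OF that] .
  have un: "square_integrable M (u n)" using insert.prems by simp
  \<comment> \<open>The usual projection coefficients. If \<open>e j\<close> has norm zero, division
    by zero gives \<open>b j = 0\<close>; this is harmless, since then \<open>e j\<close> vanishes
    almost everywhere and so does its product with \<open>u n\<close>.\<close>
  define b where "b j = (LINT x|M. u n x * e j x) / (LINT x|M. e j x * e j x)" for j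
  define v where "v x = u n x - (\<Sum>j\<in>I. b j * e j x)" for x
  have v: "square_integrable M v"
    unfolding v_def
    by (intro square_integrable_diff un square_integrable_sum square_integrable_cmult e)
  have b: "b i * (LINT x|M. e i x * e i x) = (LINT x|M. u n x * e i x)" if i: "i \<in> I" for i
  proof (cases "(LINT x|M. e i x * e i x) = 0")
    case True
    then have "AE x in M. e i x = 0" by (rule square_integrable_AE_zero[OF e[OF i]])
    then have "AE x in M. u n x * e i x = 0" by eventually_elim simp
    then have "(LINT x|M. u n x * e i x) = 0" by (rule integral_eq_zero_AE)
    with True show ?thesis by simp
  qed (simp add: b_def)
  have v_orth: "(LINT x|M. v x * e i x) = 0" if i: "i \<in> I" for i
  proof -
    have "(LINT x|M. v x * e i x) =
        (LINT x|M. u n x * e i x - (\<Sum>j\<in>I. b j * (e j x * e i x)))"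
      by (simp add: v_def left_diff_distrib sum_distrib_right mult.assoc)
    also have "\<dots> = (LINT x|M. u n x * e i x) - (\<Sum>j\<in>I. b j * (LINT x|M. e j x * e i x))"
      using i by (simp add: square_integrable_mult un e)
    also have "(\<Sum>j\<in>I. b j * (LINT x|M. e j x * e i x)) =
        (\<Sum>j\<in>I. if j = i then b i * (LINT x|M. e i x * e i x) else 0)"
      using i by (intro sum.cong) (auto simp: orth)
    also have "\<dots> = (LINT x|M. u n x * e i x)"
      using i insert.hyps by (simp add: b)
    finally show ?thesis by simp
  qed
  let ?e = "e(n := v)"
  \<comment> \<open>Row \<open>n\<close> reads off the definition of \<open>v\<close>; the old rows
    get a zero in the new column.\<close>
  let ?a = "\<lambda>i j. if i = n then (if j = n then 1 else b j) else if j = n then 0 else a i j"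
  have a': "u i x = (\<Sum>j\<in>insert n I. ?a i j * ?e j x)" if i: "i \<in> insert n I" for i x
  proof -
    have "(\<Sum>j\<in>insert n I. ?a i j * ?e j x) = ?a i n * v x + (\<Sum>j\<in>I. ?a i j * e j x)"
      using insert.hyps by (auto intro!: sum.cong)
    also have "(\<Sum>j\<in>I. ?a i j * e j x) = (\<Sum>j\<in>I. (if i = n then b j else a i j) * e j x)"
      using insert.hyps by (intro sum.cong) auto
    also have "?a i n * v x + \<dots> = u i x"
      using i by (auto simp: v_def a)
    finally show ?thesis by (rule sym)
  qed
  have e': "\<forall>i\<in>insert n I. square_integrable M (?e i)" using v e by simp
  have orth': "\<forall>i\<in>insert n I. \<forall>j\<in>insert n I. i \<noteq> j \<longrightarrow> (LINT x|M. ?e i x * ?e j x) = 0"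
    using v_orth orth by (auto simp: mult.commute[of _ "v _"])
  show ?case
    by (intro exI[of _ ?e] exI[of _ ?a] conjI e' orth' ballI allI a')
qed

text \<open>The function \<open>w\<close> is the diagonal of the reproducing kernel, so the bound is
  Cauchy-Schwarz in an orthogonal family, and each member adds at most 1 to the integral of
  \<open>w\<close>. The null set comes before the quantifier over \<open>c\<close>: it is the set
  where some almost everywhere vanishing \<open>e i\<close> is nonzero. This lets later coefficients
  depend on \<open>y\<close>.\<close>

lemma christoffel_function_exists:
  assumes I: "finite I" and u: "\<And>i. i \<in> I \<Longrightarrow> square_integrable M (u i)"
  obtains w where "\<And>y. w y \<ge> 0" "integrable M w" "(LINT y|M. w y) \<le> real (card I)"
    "AE y in M. \<forall>c. (\<Sum>i\<in>I. c i * u i y)\<^sup>2 \<le> w y * (LINT x|M. (\<Sum>i\<in>I. c i * u i x)\<^sup>2)"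
proof -
  obtain e a where ea: "(\<forall>i\<in>I. square_integrable M (e i)) \<and>
           (\<forall>i\<in>I. \<forall>j\<in>I. i \<noteq> j \<longrightarrow> (LINT x|M. e i x * e j x) = 0) \<and>
           (\<forall>i\<in>I. \<forall>x. u i x = (\<Sum>j\<in>I. a i j * e j x))"
    by (rule exE[OF orthogonal_family_exists[of I M u, OF I u]], assumption, erule exE, rule that)
  have e: "square_integrable M (e i)" if "i \<in> I" for i
    using ea[THEN conjunct1] that by (rule bspec)
  have orth: "(LINT x|M. e i x * e j x) = 0" if "i \<in> I" "j \<in> I" "i \<noteq> j" for i j
    using ea[THEN conjunct2, THEN conjunct1] that by blast
  have a: "u i x = (\<Sum>j\<in>I. a i j * e j x)" if "i \<in> I" for i x
    using ea[THEN conjunct2, THEN conjunct2, rule_format, OF that] .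
  define s where "s i = (LINT x|M. e i x * e i x)" for i
  have s: "s i \<ge> 0" for i by (simp add: s_def)
  \<comment> \<open>Division by \<open>s i = 0\<close> discards the members of the orthogonal family that vanish almost everywhere.\<close>
  define w where "w y = (\<Sum>i\<in>I. e i y * e i y / s i)" for y
  have "w y \<ge> 0" for y
    using s by (auto simp: w_def intro!: sum_nonneg)
  moreover have "integrable M w"
    unfolding w_def by (intro Bochner_Integration.integrable_sum integrable_divide square_integrable_mult e)
  \<comment> \<open>Each quotient is 1, or 0 for a degenerate member; hence only an inequality with
    the cardinality.\<close>
  moreover have "(LINT y|M. w y) = (\<Sum>i\<in>I. s i / s i)"
    by (simp add: w_def s_def square_integrable_mult e)
  then have "(LINT y|M. w y) \<le> real (card I)"
    using sum_mono[of I "\<lambda>i. s i / s i" "\<lambda>_. 1"] by (simp add: divide_self_if)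
  moreover have "AE y in M. \<forall>i\<in>I. s i = 0 \<longrightarrow> e i y = 0"
    using I by (intro AE_finite_allI) (auto simp: s_def intro: square_integrable_AE_zero e)
  then have "AE y in M. \<forall>c. (\<Sum>i\<in>I. c i * u i y)\<^sup>2 \<le> w y * (LINT x|M. (\<Sum>i\<in>I. c i * u i x)\<^sup>2)"
  proof eventually_elim
    case (elim y)
    show ?case
    proof
      fix c
      define d where "d j = (\<Sum>i\<in>I. c i * a i j)" for j
      have d: "(\<Sum>i\<in>I. c i * u i x) = (\<Sum>j\<in>I. d j * e j x)" for x
      proof -
        have "(\<Sum>i\<in>I. c i * u i x) = (\<Sum>i\<in>I. \<Sum>j\<in>I. c i * a i j * e j x)"
          by (intro sum.cong refl) (simp add: a sum_distrib_left mult.assoc)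
        also have "\<dots> = (\<Sum>j\<in>I. \<Sum>i\<in>I. c i * a i j * e j x)" by (rule sum.swap)
        also have "\<dots> = (\<Sum>j\<in>I. d j * e j x)" by (simp add: d_def sum_distrib_right)
        finally show ?thesis .
      qed
      have "(LINT x|M. (\<Sum>i\<in>I. c i * u i x)\<^sup>2) = (LINT x|M. (\<Sum>i\<in>I. \<Sum>j\<in>I. d i * d j * (e i x * e j x)))"
        by (simp add: d power2_eq_square sum_product mult_ac)
      also have "\<dots> = (\<Sum>i\<in>I. \<Sum>j\<in>I. d i * d j * (LINT x|M. e i x * e j x))"
        by (simp add: square_integrable_mult e)
      also have "\<dots> = (\<Sum>i\<in>I. \<Sum>j\<in>I. if j = i then (d i)\<^sup>2 * s i else 0)"
        by (intro sum.cong) (auto simp: orth s_def power2_eq_square)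
      also have "\<dots> = (\<Sum>i\<in>I. (d i)\<^sup>2 * s i)" using I by simp
      finally have L: "(LINT x|M. (\<Sum>i\<in>I. c i * u i x)\<^sup>2) = (\<Sum>i\<in>I. (d i)\<^sup>2 * s i)" .
      \<comment> \<open>Inserting \<open>sqrt (s i)\<close> and its inverse prepares Cauchy-Schwarz.
        Where \<open>s i = 0\<close> the right-hand term is 0, and so is the left-hand one because
        \<open>e i y = 0\<close> off the null set.\<close>
      have "(\<Sum>i\<in>I. d i * e i y) = (\<Sum>i\<in>I. (e i y / sqrt (s i)) * (d i * sqrt (s i)))"
        using elim s by (intro sum.cong) (auto simp: less_le)
      then have "(\<Sum>i\<in>I. c i * u i y)\<^sup>2 = (\<Sum>i\<in>I. (e i y / sqrt (s i)) * (d i * sqrt (s i)))\<^sup>2"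
        by (simp only: d)
      also have "\<dots> \<le> (\<Sum>i\<in>I. (e i y / sqrt (s i))\<^sup>2) * (\<Sum>i\<in>I. (d i * sqrt (s i))\<^sup>2)"
        by (rule Cauchy_Schwarz_ineq_sum)
      also have "\<dots> = w y * (LINT x|M. (\<Sum>i\<in>I. c i * u i x)\<^sup>2)"
        using s by (simp add: L w_def power_divide power_mult_distrib) (simp add: power2_eq_square)
      finally show "(\<Sum>i\<in>I. c i * u i y)\<^sup>2 \<le> w y * (LINT x|M. (\<Sum>i\<in>I. c i * u i x)\<^sup>2)" .
    qed
  qed
  ultimately show thesis by (rule that)
qed

section \<open>Pointwise bounds in translation-invariant spaces and for trigonometric
  polynomials\<close>

lemma integrable_on_ball:
  fixes h :: "'a::euclidean_space \<Rightarrow> real"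
  assumes "continuous_on UNIV h"
  shows "integrable lborel (\<lambda>x. indicator (ball a s) x *\<^sub>R h x)"
proof -
  have "set_integrable lborel (cball a s) h"
    unfolding set_integrable_def
    by (intro borel_integrable_compact compact_cball continuous_on_subset[OF assms]) auto
  then have "set_integrable lborel (ball a s) h"
    by (rule set_integrable_subset) auto
  then show ?thesis by (simp add: set_integrable_def)
qed

lemma translation_invariant_pointwise_bound:
  fixes u :: "'i \<Rightarrow> 'a::euclidean_space \<Rightarrow> real"
  assumes I: "finite I" and cont: "\<And>i. i \<in> I \<Longrightarrow> continuous_on UNIV (u i)"
    and shift: "\<And>c h. \<exists>c'. \<forall>x. (\<Sum>i\<in>I. c i * u i (x + h)) = (\<Sum>i\<in>I. c' i * u i x)"
  shows "(\<Sum>i\<in>I. c i * u i x)\<^sup>2 * measure lborel (ball (0::'a) r)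
    \<le> real (card I) * (LINT y:ball x (2 * r)|lborel. (\<Sum>i\<in>I. c i * u i y)\<^sup>2)"
proof -
  let ?M = "restrict_space lborel (ball (0::'a) r)"
  define F where "F y = (\<Sum>i\<in>I. c i * u i y)" for y
  define N where "N = (LINT y:ball x (2 * r)|lborel. (F y)\<^sup>2)"
  have contF: "continuous_on A F" for A
    unfolding F_def by (intro continuous_intros continuous_on_subset[OF cont]) auto
  have u: "square_integrable ?M (u i)" if "i \<in> I" for i
    unfolding square_integrable_def integrable_restrict_space[of "ball 0 r" lborel, simplified]
  proof
    show "u i \<in> borel_measurable ?M"
      using borel_measurable_continuous_onI[OF cont[OF that]] by (simp add: measurable_restrict_space1)
    show "integrable lborel (\<lambda>x. indicator (ball 0 r) x *\<^sub>R (u i x)\<^sup>2)"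
      by (intro integrable_on_ball continuous_intros cont that)
  qed
  obtain w where w: "\<And>y. w y \<ge> 0" "integrable ?M w" "(LINT y|?M. w y) \<le> real (card I)"
    and wb: "AE y in ?M. \<forall>c. (\<Sum>i\<in>I. c i * u i y)\<^sup>2 \<le> w y * (LINT x|?M. (\<Sum>i\<in>I. c i * u i x)\<^sup>2)"
    by (rule christoffel_function_exists[OF I u], assumption, rule that)
  \<comment> \<open>Translation carries the ball around 0 to the ball of radius \<open>r\<close>
    around \<open>x - y\<close>, which lies within \<open>2 * r\<close> of \<open>x\<close>. So
    \<open>N\<close> bounds all these norms at once.\<close>
  have shifted: "(LINT t|?M. (F (t + (x - y)))\<^sup>2) \<le> N" if y: "y \<in> ball 0 r" for y
  proof -
    have "(LINT t|?M. (F (t + (x - y)))\<^sup>2) = (LINT t|lborel. indicator (ball 0 r) t * (F (t + (x - y)))\<^sup>2)"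
      by (simp add: integral_restrict_space)
    also have "\<dots> = (LINT t|lborel. indicator (ball (x - y) r) ((x - y) + t) * (F ((x - y) + t))\<^sup>2)"
      by (intro Bochner_Integration.integral_cong refl) (auto simp: indicator_def dist_norm algebra_simps)
    also have "\<dots> = (LINT t|distr lborel borel ((+) (x - y)). indicator (ball (x - y) r) t * (F t)\<^sup>2)"
      by (intro integral_distr[symmetric] borel_measurable_times borel_measurable_indicator
          borel_measurable_power borel_measurable_continuous_onI contF) auto
    also have "\<dots> = (LINT t:ball (x - y) r|lborel. (F t)\<^sup>2)"
      by (simp add: lborel_distr_plus set_lebesgue_integral_def)
    also have "\<dots> \<le> N"
      unfolding N_def set_lebesgue_integral_def
    proof (rule integral_mono)
      have "ball (x - y) r \<subseteq> ball x (2 * r)"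
        using y by (intro ball_subset_ball_iff[THEN iffD2]) (auto simp: dist_norm)
      then show "indicator (ball (x - y) r) t *\<^sub>R (F t)\<^sup>2 \<le> indicator (ball x (2 * r)) t *\<^sub>R (F t)\<^sup>2" for t
        by (auto simp: indicator_def)
    qed (intro integrable_on_ball continuous_intros contF)+
    finally show ?thesis .
  qed
  have "AE y in ?M. (F x)\<^sup>2 \<le> w y * N"
    using wb AE_space
  proof eventually_elim
    case (elim y)
    then have y: "y \<in> ball 0 r" by (simp add: space_restrict_space)
    \<comment> \<open>The translate of \<open>F\<close> that takes the value \<open>F x\<close> at
      \<open>y\<close>. Its coefficients vary with \<open>y\<close>, which the uniformity of
      \<open>wb\<close> in the coefficients permits.\<close>
    obtain c' where c': "\<And>t. F (t + (x - y)) = (\<Sum>i\<in>I. c' i * u i t)"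
      using shift[of c "x - y"] unfolding F_def by auto
    have "(F x)\<^sup>2 \<le> w y * (LINT t|?M. (F (t + (x - y)))\<^sup>2)"
      using elim(1)[rule_format, of c'] c'[of y] by (simp add: c')
    also have "\<dots> \<le> w y * N"
      using shifted[OF y] w(1) by (rule mult_left_mono)
    finally show ?case .
  qed
  \<comment> \<open>The left integrand is constant in \<open>y\<close>, so integration produces the
    volume of the ball.\<close>
  then have "(LINT y|?M. (F x)\<^sup>2) \<le> (LINT y|?M. w y * N)"
    using w(2) integrable_on_ball[of "\<lambda>_. 1" 0 r]
    by (intro integral_mono_AE) (auto simp: integrable_restrict_space)
  also have "\<dots> = (LINT y|?M. w y) * N" by simp
  also have "\<dots> \<le> real (card I) * N"
    using w(3) by (intro mult_right_mono) (auto simp: N_def set_lebesgue_integral_def)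
  finally show ?thesis
    by (simp add: F_def N_def integral_restrict_space mult.commute measure_restrict_space)
qed

text \<open>The cosines and sines of the \<open>k\<close> frequencies span a translation-invariant
  real space by the addition formulas; these \<open>2 * k\<close> functions account for the factor
  2. A rotation of the phase reduces the complex polynomial to a real member of this space.\<close>

lemma trig_poly_pointwise_bound:
  assumes "trig_poly_degree_le k P"
  shows "(cmod (P x))\<^sup>2 * measure lborel (ball (0::plane) r)
    \<le> 2 * real k * (LINT y:ball x (2 * r)|lborel. (cmod (P y))\<^sup>2)"
proof -
  obtain c :: "nat \<Rightarrow> complex" and \<xi> :: "nat \<Rightarrow> plane"
    where P: "\<And>x. P x = (\<Sum>i=1..k. c i * cis (2 * pi * (x \<bullet> \<xi> i)))"
    using assms by (auto simp: trig_poly_degree_le_def)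
  define I where "I = {1..k} \<times> (UNIV :: bool set)"
  define u where "u = (\<lambda>(i, b) x. if b then cos (2 * pi * (x \<bullet> \<xi> i)) else sin (2 * pi * (x \<bullet> \<xi> i)))"
  have I: "finite I" "card I = 2 * k" by (simp_all add: I_def card_cartesian_product)
  have sumI: "(\<Sum>p\<in>I. d p * u p x) = (\<Sum>i=1..k. d (i, True) * cos (2 * pi * (x \<bullet> \<xi> i))
      + d (i, False) * sin (2 * pi * (x \<bullet> \<xi> i)))" for d x
    unfolding I_def sum.cartesian_product' by (simp add: u_def UNIV_bool add.commute)
  have cont: "continuous_on UNIV (u p)" for p
    by (cases p; cases "snd p") (auto simp: u_def intro!: continuous_intros)
  have shift: "\<exists>d'. \<forall>x. (\<Sum>p\<in>I. d p * u p (x + h)) = (\<Sum>p\<in>I. d' p * u p x)" for d h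
  proof (intro exI allI)
    let ?d' = "\<lambda>(i, b). if b
          then d (i, True) * cos (2 * pi * (h \<bullet> \<xi> i)) + d (i, False) * sin (2 * pi * (h \<bullet> \<xi> i))
          else d (i, False) * cos (2 * pi * (h \<bullet> \<xi> i)) - d (i, True) * sin (2 * pi * (h \<bullet> \<xi> i))"
    show "(\<Sum>p\<in>I. d p * u p (x + h)) = (\<Sum>p\<in>I. ?d' p * u p x)" for x
      unfolding sumI inner_add_left distrib_left cos_add sin_add
      by (intro sum.cong refl) (simp add: algebra_simps)
  qed
  \<comment> \<open>Multiplication by \<omega> makes the value at \<open>x\<close> equal to its
    modulus and increases no modulus elsewhere. If \<open>P x = 0\<close>, then \<open>sgn\<close>
    gives \<omega> = 0 and the bound is trivial.\<close>
  define \<omega> where "\<omega> = cnj (sgn (P x))"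
  \<comment> \<open>The minus sign comes from Re((a + ib)(cos s + i sin s)) = a cos s - b sin
    s.\<close>
  define d where "d = (\<lambda>(i, b). if b then Re (\<omega> * c i) else - Im (\<omega> * c i))"
  have d: "(\<Sum>p\<in>I. d p * u p y) = Re (\<omega> * P y)" for y
    unfolding sumI P sum_distrib_left Re_sum
    by (intro sum.cong refl) (simp add: d_def algebra_simps)
  have contP: "continuous_on A P" for A
    unfolding P cis_conv_exp by (intro continuous_intros)
  have le: "(Re (\<omega> * P y))\<^sup>2 \<le> (cmod (P y))\<^sup>2" for y
  proof -
    have "\<bar>Re (\<omega> * P y)\<bar> \<le> cmod \<omega> * cmod (P y)"
      by (metis abs_Re_le_cmod norm_mult)
    also have "\<dots> \<le> cmod (P y)" by (simp add: \<omega>_def norm_sgn)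
    finally show ?thesis by (simp add: abs_le_square_iff[symmetric])
  qed
  have "\<omega> * P x = of_real (cmod (P x))"
    using complex_norm_square[of "P x"]
    by (cases "P x = 0")
      (auto simp: \<omega>_def sgn_div_norm scaleR_conv_of_real power2_eq_square mult_ac divide_simps)
  then have "(cmod (P x))\<^sup>2 * measure lborel (ball (0::plane) r) =
      (\<Sum>p\<in>I. d p * u p x)\<^sup>2 * measure lborel (ball (0::plane) r)"
    by (simp add: d)
  also have "\<dots> \<le> real (card I) * (LINT y:ball x (2 * r)|lborel. (\<Sum>p\<in>I. d p * u p y)\<^sup>2)"
    by (rule translation_invariant_pointwise_bound[OF I(1) cont shift])
  also have "\<dots> \<le> 2 * real k * (LINT y:ball x (2 * r)|lborel. (cmod (P y))\<^sup>2)"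
    unfolding I d set_lebesgue_integral_def of_nat_mult of_nat_numeral
    by (intro mult_left_mono integral_mono integrable_on_ball continuous_intros contP) (use le in \<open>auto simp: indicator_def\<close>)
  finally show ?thesis .
qed

section \<open>Approximating a concentrated function by a spread-out one\<close>

text \<open>On \<open>E\<close> split \<open>g\<close> as \<open>(g - P) + P\<close>; off
  \<open>E\<close> it vanishes. The first part costs the approximation error, the second only the
  small mass of \<open>P\<close> on \<open>E\<close>. Keeping \<open>t\<close> free lets the factor
  before \<theta> approach 1, so that every \<theta> below 1 can be excluded.\<close>

lemma spread_approximation_necessary_condition:
  fixes g :: "'a \<Rightarrow> real" and P :: "'a \<Rightarrow> complex"
  assumes [measurable]: "g \<in> borel_measurable M" "P \<in> borel_measurable M" "E \<in> sets M"
    and intg: "integrable M (\<lambda>x. (g x)\<^sup>2)" and intP: "integrable M (\<lambda>x. (cmod (P x))\<^sup>2)"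
    and supp: "\<And>x. x \<in> space M \<Longrightarrow> x \<notin> E \<Longrightarrow> g x = 0"
    and approx: "(LINT x|M. (cmod (of_real (g x) - P x))\<^sup>2) \<le> \<theta> * (LINT x|M. (g x)\<^sup>2)"
    and spread: "(LINT x|M. indicator E x * (cmod (P x))\<^sup>2) \<le> \<epsilon> * (LINT x|M. (cmod (P x))\<^sup>2)"
    and pos: "(LINT x|M. (g x)\<^sup>2) > 0" and t: "t > 0" and "\<theta> \<le> 1" "\<epsilon> \<ge> 0"
  shows "1 \<le> (1 + t) * \<theta> + (1 + 1 / t) * (4 * \<epsilon>)"
proof -
  define A where "A = (LINT x|M. (g x)\<^sup>2)"
  have peter_paul: "(cmod (a + b))\<^sup>2 \<le> (1 + s) * (cmod a)\<^sup>2 + (1 + 1 / s) * (cmod b)\<^sup>2"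
    if s: "s > 0" for a b :: complex and s :: real
  proof -
    have "0 \<le> (sqrt s * cmod a - cmod b / sqrt s)\<^sup>2" by simp
    also have "\<dots> = s * (cmod a)\<^sup>2 + (cmod b)\<^sup>2 / s - 2 * cmod a * cmod b"
      using s by (simp add: power2_diff power_mult_distrib power_divide)
    finally have "(cmod a + cmod b)\<^sup>2 \<le> (1 + s) * (cmod a)\<^sup>2 + (1 + 1 / s) * (cmod b)\<^sup>2"
      by (simp add: power2_sum algebra_simps)
    moreover have "(cmod (a + b))\<^sup>2 \<le> (cmod a + cmod b)\<^sup>2"
      by (intro power_mono norm_triangle_ineq) auto
    ultimately show ?thesis by linarith
  qed
  have intD: "integrable M (\<lambda>x. (cmod (of_real (g x) - P x))\<^sup>2)"
  proof (rule Bochner_Integration.integrable_bound)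
    show "integrable M (\<lambda>x. 2 * (g x)\<^sup>2 + 2 * (cmod (P x))\<^sup>2)" using intg intP by simp
    show "AE x in M. norm ((cmod (of_real (g x) - P x))\<^sup>2) \<le> norm (2 * (g x)\<^sup>2 + 2 * (cmod (P x))\<^sup>2)"
      using peter_paul[of 1 "of_real (g x)" "- P x" for x] by simp
  qed measurable
  have intE: "integrable M (\<lambda>x. indicator E x * (cmod (P x))\<^sup>2)"
    using integrable_mult_indicator[OF \<open>E \<in> sets M\<close> intP] by simp
  \<comment> \<open>The splitting with parameter 1 bounds the mass of \<open>P\<close> by
    \<open>2 * \<theta> * A + 2 * A\<close>, hence by \<open>4 * A\<close>. This is the origin of
    the 4 in the conclusion.\<close>
  have "(LINT x|M. (cmod (P x))\<^sup>2) \<le> (LINT x|M. 2 * (cmod (of_real (g x) - P x))\<^sup>2 + 2 * (g x)\<^sup>2)"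
    using intg intP intD peter_paul[of 1 "P x - of_real (g x)" "of_real (g x)" for x]
    by (intro integral_mono) (auto simp: norm_minus_commute)
  also have "\<dots> = 2 * (LINT x|M. (cmod (of_real (g x) - P x))\<^sup>2) + 2 * A"
    using intg intD by (simp add: A_def)
  also have "\<dots> \<le> 4 * A"
    using approx pos mult_right_mono[OF \<open>\<theta> \<le> 1\<close>, of A] unfolding A_def by linarith
  finally have P: "(LINT x|M. (cmod (P x))\<^sup>2) \<le> 4 * A" .
  have "A \<le> (LINT x|M. (1 + t) * (cmod (of_real (g x) - P x))\<^sup>2
      + (1 + 1 / t) * (indicator E x * (cmod (P x))\<^sup>2))"
    unfolding A_def
  proof (rule integral_mono)
    show "(g x)\<^sup>2 \<le> (1 + t) * (cmod (of_real (g x) - P x))\<^sup>2 + (1 + 1 / t) * (indicator E x * (cmod (P x))\<^sup>2)"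
      if "x \<in> space M" for x
      using peter_paul[OF t, of "of_real (g x) - P x" "P x"] supp[OF that] t by (cases "x \<in> E") auto
  qed (use intg intD intE in auto)
  also have "\<dots> = (1 + t) * (LINT x|M. (cmod (of_real (g x) - P x))\<^sup>2)
      + (1 + 1 / t) * (LINT x|M. indicator E x * (cmod (P x))\<^sup>2)"
    using intD intE by simp
  also have "\<dots> \<le> (1 + t) * (\<theta> * A) + (1 + 1 / t) * (\<epsilon> * (4 * A))"
    using approx spread t mult_left_mono[OF P \<open>\<epsilon> \<ge> 0\<close>]
    by (intro add_mono mult_left_mono) (auto simp: A_def)
  finally have "1 * A \<le> ((1 + t) * \<theta> + (1 + 1 / t) * (4 * \<epsilon>)) * A"
    by (simp add: algebra_simps)
  then show ?thesis using pos by (simp add: A_def)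
qed

section \<open>From extended-real norms to real integrals\<close>

lemma Lp_norm_2_eq_sqrt:
  assumes "integrable M (\<lambda>x. (norm (h x))\<^sup>2)"
  shows "Lp_norm 2 M h = ennreal (sqrt (LINT x|M. (norm (h x))\<^sup>2))"
proof -
  have "(\<integral>\<^sup>+x. ennreal (norm (h x) powr 2) \<partial>M) = ennreal (LINT x|M. (norm (h x))\<^sup>2)"
    using assms by (simp add: nn_integral_eq_integral)
  then show ?thesis by (simp add: Lp_norm_def powr_half_sqrt)
qed

lemma square_integral_le_of_Lp_norm_2_le:
  assumes "integrable M (\<lambda>x. (norm (h x))\<^sup>2)" "integrable M (\<lambda>x. (norm (g x))\<^sup>2)" "\<eta> \<ge> 0"
    and "Lp_norm 2 M h \<le> ennreal \<eta> * Lp_norm 2 M g"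
  shows "(LINT x|M. (norm (h x))\<^sup>2) \<le> \<eta>\<^sup>2 * (LINT x|M. (norm (g x))\<^sup>2)"
proof -
  have "sqrt (LINT x|M. (norm (h x))\<^sup>2) \<le> \<eta> * sqrt (LINT x|M. (norm (g x))\<^sup>2)"
    using assms by (simp add: Lp_norm_2_eq_sqrt ennreal_mult[symmetric])
  then have "(sqrt (LINT x|M. (norm (h x))\<^sup>2))\<^sup>2 \<le> (\<eta> * sqrt (LINT x|M. (norm (g x))\<^sup>2))\<^sup>2"
    by (intro power_mono) auto
  then show ?thesis by (simp add: power_mult_distrib)
qed

section \<open>Test functions and the mollified measure\<close>

lemma test_function_continuous: "test_function \<psi> \<Longrightarrow> continuous_on UNIV \<psi>"
  unfolding test_function_def by (metis times_cont_differentiable.simps(1))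

lemma test_function_support_bounded:
  assumes "test_function \<psi>"
  obtains K where "K > 0" "\<And>x. \<psi> x \<noteq> 0 \<Longrightarrow> norm x < K"
proof -
  have "bounded (closure {x. \<psi> x \<noteq> 0})"
    using assms by (auto simp: test_function_def intro: compact_imp_bounded)
  then obtain K where K: "K > 0" "\<And>x. x \<in> closure {x. \<psi> x \<noteq> 0} \<Longrightarrow> norm x < K"
    by (auto simp: bounded_pos_less)
  show thesis
    by (rule that[OF K(1)], rule K(2), rule subsetD[OF closure_subset]) simp
qed

lemma test_function_bounded:
  fixes \<psi> :: "'a::euclidean_space \<Rightarrow> real"
  assumes "test_function \<psi>"
  obtains B where "\<And>x. \<bar>\<psi> x\<bar> \<le> B"
proof -
  have "compact (\<psi> ` closure {x. \<psi> x \<noteq> 0})"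
    using assms
    by (intro compact_continuous_image continuous_on_subset[OF test_function_continuous])
       (auto simp: test_function_def)
  then have "bounded (\<psi> ` closure {x. \<psi> x \<noteq> 0})"
    by (rule compact_imp_bounded)
  then obtain B where "\<forall>y\<in>\<psi> ` closure {x. \<psi> x \<noteq> 0}. norm y \<le> B"
    unfolding bounded_iff by (elim exE) (rule that)
  then have B: "\<bar>\<psi> x\<bar> \<le> B" if "x \<in> closure {x. \<psi> x \<noteq> 0}" for x
    using that by simp
  \<comment> \<open>The maximum is needed because \<open>B\<close> may be negative if the support is
    empty.\<close>
  have "\<bar>\<psi> x\<bar> \<le> max B 0" for x
  proof (cases "\<psi> x = 0")
    case False
    then have "x \<in> closure {x. \<psi> x \<noteq> 0}" by (intro subsetD[OF closure_subset]) simp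
    from B[OF this] show ?thesis by simp
  qed simp
  then show thesis by (rule that)
qed

lemma trig_poly_continuous: "trig_poly_degree_le k P \<Longrightarrow> continuous_on A P"
proof -
  assume "trig_poly_degree_le k P"
  then obtain c :: "nat \<Rightarrow> complex" and \<xi> :: "nat \<Rightarrow> plane"
    where P: "P = (\<lambda>x. \<Sum>i=1..k. c i * cis (2 * pi * (x \<bullet> \<xi> i)))"
    by (auto simp: trig_poly_degree_le_def)
  show ?thesis
    unfolding P cis_conv_exp by (intro continuous_intros)
qed

text \<open>The size bound holds because a probability measure averages a kernel of height at most
  \<open>B * R\<^sup>2\<close>. The support radius adds \<open>1 / R\<close> from the ball and
  \<open>K / R\<close> from the dilated bump. Positivity on some ball uses that every neighbourhood
  of a support point has mass.\<close>

lemma weighted_conv_ball_properties: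
  fixes \<psi> :: "plane \<Rightarrow> real"
  assumes "prob_space \<mu>" and sets: "sets \<mu> = sets borel"
    and psi: "continuous_on UNIV \<psi>" "\<And>x. \<psi> x \<ge> 0" "\<And>x. \<psi> x \<noteq> 0 \<Longrightarrow> norm x < K" "\<And>x. \<bar>\<psi> x\<bar> \<le> B" "\<psi> p > 0"
    and z: "z \<in> topological_support \<mu>" and R: "R > 0"
  defines "g \<equiv> weighted_conv (indicator (ball z (1 / R))) \<mu> (dilate (1 / R) \<psi>)"
  shows "g \<in> borel_measurable borel"
    and "\<bar>g x\<bar> \<le> B * R\<^sup>2"
    and "x \<notin> ball z ((K + 1) / R) \<Longrightarrow> g x = 0"
    and "\<exists>a s. s > 0 \<and> (\<forall>x\<in>ball a s. g x > 0)"
proof -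
  interpret prob_space \<mu> by fact
  note [measurable_cong] = sets
  define h where "h x y = indicator (ball z (1 / R)) y * (\<psi> (R *\<^sub>R (x - y)) * R\<^sup>2)" for x y
  have g: "g = (\<lambda>x. LINT y|\<mu>. h x y)"
    using R by (simp add: g_def h_def weighted_conv_def dilate_def fun_eq_iff power_divide)
  have [measurable]: "\<psi> \<in> borel_measurable borel"
    using psi(1) by (rule borel_measurable_continuous_onI)
  have [measurable]: "ball z (1 / R) \<in> sets borel" by simp
  have h_meas0: "(\<lambda>(x, y). h x y) \<in> borel_measurable (borel \<Otimes>\<^sub>M borel)"
    unfolding h_def by measurable
  then have h_meas: "(\<lambda>(x, y). h x y) \<in> borel_measurable (borel \<Otimes>\<^sub>M \<mu>)"
    using measurable_cong_sets[OF sets_pair_measure_cong[OF refl sets] refl] by blast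
  then show "g \<in> borel_measurable borel"
    unfolding g by (rule borel_measurable_lebesgue_integral)
  have h_meas1 [measurable]: "h x \<in> borel_measurable \<mu>" for x
    using measurable_compose[OF measurable_Pair1' h_meas] by simp
  have B: "B \<ge> 0" using psi(4)[of 0] by linarith
  have h_le: "\<bar>h x y\<bar> \<le> B * R\<^sup>2" for x y
    using psi(4)[of "R *\<^sub>R (x - y)"] B R by (auto simp: h_def indicator_def abs_mult intro: mult_right_mono)
  have h_int: "integrable \<mu> (h x)" for x
    by (rule integrable_const_bound[of _ "B * R\<^sup>2"]) (use h_le in auto)
  have h_nonneg: "h x y \<ge> 0" for x y
    using psi(2) R by (simp add: h_def)
  have "g x \<le> (LINT y|\<mu>. B * R\<^sup>2)"
    unfolding g using h_int h_le by (intro integral_mono) (auto intro: order_trans[OF abs_ge_self])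
  moreover have "g x \<ge> 0" unfolding g using h_nonneg by simp
  ultimately show "\<bar>g x\<bar> \<le> B * R\<^sup>2" by (simp add: prob_space)
  show "g x = 0" if x: "x \<notin> ball z ((K + 1) / R)"
  proof -
    have "h x y = 0" for y
    proof (rule ccontr)
      assume "h x y \<noteq> 0"
      then have y: "dist z y < 1 / R" and "norm (R *\<^sub>R (x - y)) < K"
        using psi(3)[of "R *\<^sub>R (x - y)"] by (auto simp: h_def indicator_def split: if_splits)
      then have "dist y x < K / R"
        using R unfolding norm_scaleR by (simp add: dist_norm norm_minus_commute pos_less_divide_eq mult.commute)
      with y have "dist z x < 1 / R + K / R"
        using dist_triangle[of z x y] by linarith
      then show False using x by (simp add: add_divide_distrib add.commute)
    qed
    then have "h x = (\<lambda>_. 0)" by auto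
    then show ?thesis by (simp add: g)
  qed
  obtain d where d: "d > 0" "\<And>q. dist q p < d \<Longrightarrow> \<psi> q > 0"
  proof -
    have "open {q. 0 < \<psi> q}"
      using psi(1) by (intro open_Collect_less continuous_on_const)
    then show thesis using that psi(5) by (auto simp: open_dist)
  qed
  \<comment> \<open>The first bound keeps \<open>y\<close> in \<open>ball z (1 / R)\<close>. The
    second keeps \<open>R *\<^sub>R (x - y)\<close> within \<open>d\<close> of \<open>p\<close> when
    \<open>x\<close> and \<open>y\<close> deviate by less than \<open>s\<close> from
    \<open>z + p /\<^sub>R R\<close> and \<open>z\<close>.\<close>
  define s where "s = min (1 / R) (d / (2 * R))"
  have s: "s > 0" using d R by (simp add: s_def)
  have "g x > 0" if x: "x \<in> ball (z + p /\<^sub>R R) s" for x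
  proof -
    have pos: "h x y > 0" if y: "y \<in> ball z s" for y
    proof -
      have "R *\<^sub>R (x - y) - p = R *\<^sub>R ((x - (z + p /\<^sub>R R)) - (y - z))"
        using R by (simp add: algebra_simps)
      then have "dist (R *\<^sub>R (x - y)) p = R * norm ((x - (z + p /\<^sub>R R)) - (y - z))"
        using R by (simp add: dist_norm)
      also have "\<dots> < R * (s + s)"
        using x y R norm_triangle_ineq4[of "x - (z + p /\<^sub>R R)" "y - z"]
        by (intro mult_strict_left_mono) (auto simp: dist_norm norm_minus_commute)
      also have "\<dots> \<le> R * (d / (2 * R) + d / (2 * R))"
        using R by (intro mult_left_mono add_mono) (auto simp: s_def)
      also have "\<dots> = d" using R by (simp add: field_simps)
      finally have "\<psi> (R *\<^sub>R (x - y)) > 0" by (rule d(2))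
      moreover have "y \<in> ball z (1 / R)" using y by (simp add: s_def)
      ultimately show ?thesis using R by (simp add: h_def)
    qed
    have "g x \<noteq> 0"
    proof
      assume "g x = 0"
      then have "AE y in \<mu>. h x y = 0"
        unfolding g using integral_nonneg_eq_0_iff_AE[OF h_int] h_nonneg by simp
      then have "AE y in \<mu>. y \<notin> ball z s"
        by eventually_elim (use pos in force)
      then have "emeasure \<mu> (ball z s) = 0"
        by (intro null_setsD1) (simp add: AE_iff_null_sets sets)
      moreover have "emeasure \<mu> (ball z s) > 0"
        using z s by (auto simp: topological_support_def)
      ultimately show False by simp
    qed
    moreover have "g x \<ge> 0" unfolding g using h_nonneg by simp
    ultimately show ?thesis by simp
  qed
  with s show "\<exists>a s. s > 0 \<and> (\<forall>x\<in>ball a s. g x > 0)" by blast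
qed

section \<open>The necessary condition at a single scale\<close>

text \<open>The pointwise bound at the fixed radius \<open>c / 4\<close>, integrated over the ball
  of radius \<open>(K + 1) / R\<close> that carries \<open>g\<close>, shows how little of
  \<open>P\<close> lives there; the concentration criterion then applies with \<theta> equal to the
  square of \<eta>.\<close>

lemma sparse_approximation_necessary_condition:
  fixes \<psi> :: "plane \<Rightarrow> real"
  assumes "prob_space \<mu>" and sets: "sets \<mu> = sets borel"
    and psi: "continuous_on UNIV \<psi>" "\<And>x. \<psi> x \<ge> 0" "\<And>x. \<psi> x \<noteq> 0 \<Longrightarrow> norm x < K" "\<And>x. \<bar>\<psi> x\<bar> \<le> B" "\<psi> p > 0"
    and z: "z \<in> topological_support \<mu>" and R: "R > 0"
    and c: "c > 0" "ball z c \<subseteq> unit_square" "(K + 1) / R \<le> c / 2" and K: "K > 0"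
    and P: "trig_poly_degree_le k P" and \<eta>: "0 < \<eta>" "\<eta> < 1" and t: "t > 0"
  defines "g \<equiv> weighted_conv (indicator (ball z (1 / R))) \<mu> (dilate (1 / R) \<psi>)"
  assumes approx: "Lp_norm 2 (restrict_space lborel unit_square) (\<lambda>x. complex_of_real (g x) - P x)
       \<le> ennreal \<eta> * Lp_norm 2 (restrict_space lborel unit_square) g"
  shows "1 \<le> (1 + t) * \<eta>\<^sup>2 + (1 + 1 / t) * (4 * (2 * (4 / c)\<^sup>2 * (K + 1)\<^sup>2 * (real k / R\<^sup>2)))"
proof -
  let ?M = "restrict_space lborel unit_square"
  let ?E = "ball z ((K + 1) / R)"
  note G = weighted_conv_ball_properties[OF assms(1-9), folded g_def]
  have E: "?E \<subseteq> ball z (c / 2)" using c(3) by (rule subset_ball)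
  moreover have "ball z (c / 2) \<subseteq> ball z c" using c(1) by (intro subset_ball) simp
  ultimately have ES: "?E \<subseteq> unit_square" using c(2) by blast
  have contP: "continuous_on A P" for A using P by (rule trig_poly_continuous)
  have [measurable]: "P \<in> borel_measurable ?M" "g \<in> borel_measurable ?M" "?E \<in> sets ?M"
    using G(1) ES by (auto intro!: measurable_restrict_space1 borel_measurable_continuous_onI contP
        simp: sets_restrict_space_iff)
  have fin: "finite_measure ?M"
    using emeasure_lborel_cbox_finite[of 0 "1 :: plane"]
    by (intro finite_measureI) (simp add: emeasure_restrict_space space_restrict_space)
  interpret finite_measure ?M by fact
  have "(g x)\<^sup>2 \<le> (B * R\<^sup>2)\<^sup>2" for x
    using power_mono[OF G(2)[of x] abs_ge_zero, of 2] by simp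
  then have intg: "integrable ?M (\<lambda>x. (g x)\<^sup>2)"
    by (intro integrable_const_bound[of _ "(B * R\<^sup>2)\<^sup>2"]) auto
  have setP: "set_integrable lborel unit_square (\<lambda>x. (cmod (P x))\<^sup>2)"
    unfolding set_integrable_def by (intro borel_integrable_compact compact_cbox continuous_intros contP)
  then have intP: "integrable ?M (\<lambda>x. (cmod (P x))\<^sup>2)"
    by (simp add: integrable_restrict_space set_integrable_def)
  have intD: "integrable ?M (\<lambda>x. (cmod (of_real (g x) - P x))\<^sup>2)"
  proof (rule Bochner_Integration.integrable_bound)
    show "integrable ?M (\<lambda>x. 2 * (g x)\<^sup>2 + 2 * (cmod (P x))\<^sup>2)" using intg intP by simp
    have "(cmod (of_real a - b))\<^sup>2 \<le> 2 * a\<^sup>2 + 2 * (cmod b)\<^sup>2" for a b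
    proof -
      have "(cmod (of_real a - b))\<^sup>2 \<le> (\<bar>a\<bar> + cmod b)\<^sup>2"
        using norm_triangle_ineq4[of "of_real a" b] by (intro power_mono) auto
      also have "\<dots> \<le> 2 * a\<^sup>2 + 2 * (cmod b)\<^sup>2"
        using sum_squares_bound[of "\<bar>a\<bar>" "cmod b"] by (simp add: power2_sum)
      finally show ?thesis .
    qed
    then show "AE x in ?M. norm ((cmod (of_real (g x) - P x))\<^sup>2) \<le> norm (2 * (g x)\<^sup>2 + 2 * (cmod (P x))\<^sup>2)"
      by simp
  qed measurable
  define N where "N = (LINT x|?M. (cmod (P x))\<^sup>2)"
  define \<beta> where "\<beta> = measure lborel (ball (0::plane) 1)"
  have content: "measure lborel (ball a r) = r\<^sup>2 * \<beta>" if "r \<ge> 0" for a :: plane and r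
    unfolding \<beta>_def using content_ball_conv_unit_ball[OF that, of a] by simp
  have \<beta>: "\<beta> > 0" by (simp add: \<beta>_def content_ball_pos)
  \<comment> \<open>A point of \<open>?E\<close> is within \<open>c / 2\<close> of \<open>z\<close>,
    so the doubled ball of radius \<open>2 * (c / 4)\<close> around it stays inside
    \<open>ball z c\<close> and thus inside the square.\<close>
  have pointwise: "(cmod (P x))\<^sup>2 \<le> 2 * real k * N / ((c / 4)\<^sup>2 * \<beta>)" if x: "x \<in> ?E" for x
  proof -
    have "ball x (2 * (c / 4)) \<subseteq> unit_square"
    proof -
      have zx: "dist z x < c / 2" using x E by auto
      have "ball x (2 * (c / 4)) \<subseteq> ball z c"
      proof
        show "y \<in> ball z c" if "y \<in> ball x (2 * (c / 4))" for y
          using that zx dist_triangle[of z y x] by simp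
      qed
      with c show ?thesis by blast
    qed
    then have "(LINT y:ball x (2 * (c / 4))|lborel. (cmod (P y))\<^sup>2) \<le> (LINT y:unit_square|lborel. (cmod (P y))\<^sup>2)"
      using set_integrable_subset[OF setP, of "ball x (2 * (c / 4))"] setP
      unfolding set_lebesgue_integral_def set_integrable_def
      by (intro integral_mono) (auto simp: indicator_def)
    also have "\<dots> = N"
      by (simp add: N_def set_lebesgue_integral_def integral_restrict_space)
    finally have le: "(LINT y:ball x (2 * (c / 4))|lborel. (cmod (P y))\<^sup>2) \<le> N" .
    have "(cmod (P x))\<^sup>2 * ((c / 4)\<^sup>2 * \<beta>)
        \<le> 2 * real k * (LINT y:ball x (2 * (c / 4))|lborel. (cmod (P y))\<^sup>2)"
      using trig_poly_pointwise_bound[OF P, of x "c / 4"] content[of "c / 4" 0] c by simp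
    also have "\<dots> \<le> 2 * real k * N"
      using le by (rule mult_left_mono) simp
    finally have "(cmod (P x))\<^sup>2 * ((c / 4)\<^sup>2 * \<beta>) \<le> 2 * real k * N" .
    then show ?thesis using c \<beta> by (simp add: pos_le_divide_eq)
  qed
  \<comment> \<open>The area of \<open>?E\<close> times the pointwise bound, divided by
    \<open>N\<close>; the area \<beta> of the unit disc cancels.\<close>
  define \<epsilon> where "\<epsilon> = 2 * (4 / c)\<^sup>2 * (K + 1)\<^sup>2 * (real k / R\<^sup>2)"
  have "(LINT x|?M. indicator ?E x * (cmod (P x))\<^sup>2) \<le> (LINT x|?M. indicator ?E x * (2 * real k * N / ((c / 4)\<^sup>2 * \<beta>)))"
  proof (rule integral_mono)
    show "integrable ?M (\<lambda>x. indicator ?E x * (cmod (P x))\<^sup>2)"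
      using integrable_mult_indicator[OF \<open>?E \<in> sets ?M\<close> intP] by simp
    have "integrable ?M (indicator ?E :: plane \<Rightarrow> real)"
      by (rule integrable_const_bound[of _ 1]) auto
    then show "integrable ?M (\<lambda>x. indicator ?E x * (2 * real k * N / ((c / 4)\<^sup>2 * \<beta>)))"
      by (rule integrable_mult_left)
    show "indicator ?E x * (cmod (P x))\<^sup>2 \<le> indicator ?E x * (2 * real k * N / ((c / 4)\<^sup>2 * \<beta>))" for x
      using pointwise[of x] by (cases "x \<in> ?E") auto
  qed
  also have "\<dots> = measure lborel ?E * (2 * real k * N / ((c / 4)\<^sup>2 * \<beta>))"
    using ES by (simp add: measure_restrict_space Int_absorb2 space_restrict_space)
  also have "\<dots> = \<epsilon> * N"
    using content[of "(K + 1) / R" z] c \<beta> R K by (simp add: \<epsilon>_def field_simps)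
  finally have spread: "(LINT x|?M. indicator ?E x * (cmod (P x))\<^sup>2) \<le> \<epsilon> * N" .
  have pos: "(LINT x|?M. (g x)\<^sup>2) > 0"
  proof -
    obtain a s where as: "s > 0" "\<And>x. x \<in> ball a s \<Longrightarrow> g x > 0" using G(4) by blast
    \<comment> \<open>The ball on which \<open>g\<close> is positive must lie in \<open>?E\<close>,
      as \<open>g\<close> vanishes elsewhere, and \<open>?E\<close> lies in the square.\<close>
    have "ball a s \<subseteq> unit_square"
    proof
      show "x \<in> unit_square" if "x \<in> ball a s" for x
        using as(2)[OF that] G(3)[of x] ES by (cases "x \<in> ?E") auto
    qed
    then have sub: "ball a s \<subseteq> unit_square" "ball a s \<in> sets ?M" by (auto simp: sets_restrict_space_iff)
    have "(LINT x|?M. (g x)\<^sup>2) \<noteq> 0"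
    proof
      assume "(LINT x|?M. (g x)\<^sup>2) = 0"
      then have "AE x in ?M. g x = 0"
        using integral_nonneg_eq_0_iff_AE[OF intg] by simp
      then have "AE x in ?M. x \<notin> ball a s"
        by eventually_elim (use as(2) in force)
      then have "emeasure ?M (ball a s) = 0"
        using sub(2) by (intro null_setsD1) (simp add: AE_iff_null_sets)
      then show False
        using sub content_ball_pos[OF as(1), of a] by (simp add: emeasure_restrict_space measure_def)
    qed
    then show ?thesis by (simp add: less_le)
  qed
  have "(LINT x|?M. (cmod (of_real (g x) - P x))\<^sup>2) \<le> \<eta>\<^sup>2 * (LINT x|?M. (g x)\<^sup>2)"
    using square_integral_le_of_Lp_norm_2_le[OF intD _ _ approx] intg \<eta> by simp
  then show ?thesis
    using spread pos t \<eta> G(3) unfolding \<epsilon>_def[symmetric] N_def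
    by (intro spread_approximation_necessary_condition[of g ?M P ?E])
       (auto simp: \<epsilon>_def power_le_one intg intP)
qed

section \<open>Distance to the boundary and the limit of large scales\<close>

lemma AE_closed_imp_topological_support_subset:
  assumes "AE x in \<mu>. x \<in> S" "closed S" "sets \<mu> = sets borel"
  shows "topological_support \<mu> \<subseteq> S"
proof
  fix z assume z: "z \<in> topological_support \<mu>"
  have "emeasure \<mu> (- S) = 0"
    using assms by (intro null_setsD1) (simp add: AE_iff_null_sets borel_comp)
  then show "z \<in> S"
    using z assms(2) by (auto simp: topological_support_def open_Compl)
qed

text \<open>A ball is connected, so one that contains a point of \<open>S\<close> and also leaves
  \<open>S\<close> must cross the frontier.\<close>

lemma ball_subset_if_infdist_frontier:
  fixes S :: "'a::euclidean_space set"
  assumes "z \<in> S" "infdist z (frontier S) \<ge> c"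
  shows "ball z c \<subseteq> S"
proof (rule ccontr)
  assume not: "\<not> ball z c \<subseteq> S"
  then have "z \<in> ball z c" by (metis ball_eq_empty centre_in_ball empty_subsetI not_le)
  with not assms(1) have "ball z c \<inter> frontier S \<noteq> {}"
    by (intro connected_Int_frontier connected_ball) blast+
  then obtain w where "dist z w < c" "w \<in> frontier S" by auto
  then show False using infdist_le[of w "frontier S" z] assms(2) by linarith
qed

theorem proposition5p4:
  fixes \<psi> :: "plane \<Rightarrow> real" and \<mu> :: "plane measure" and z :: "real \<Rightarrow> plane"
    and f g :: "real \<Rightarrow> plane \<Rightarrow> real"
  assumes psi: "test_function \<psi>" "\<And>x. \<psi> x \<ge> 0" "(LINT x|lborel. \<psi> x) = 1"
    and mu: "Laba_Wang_measure \<mu>"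
    and centre: "\<And>R. R \<ge> 1 \<Longrightarrow> z R \<in> topological_support \<mu>"
    and centre_not_to_boundary:
      "\<not> ((\<lambda>R. infdist (z R) (frontier unit_square)) \<longlongrightarrow> 0) at_top"
    and f: "\<And>R. R \<ge> 1 \<Longrightarrow> f R = indicator (ball (z R) (1 / R))"
    and g: "\<And>R. R \<ge> 1 \<Longrightarrow> g R = weighted_conv (f R) \<mu> (dilate (1 / R) \<psi>)"
  shows "\<not> (\<exists>(\<eta>::real) (k :: real \<Rightarrow> nat) (P :: real \<Rightarrow> plane \<Rightarrow> complex).
            0 < \<eta> \<and> \<eta> < 1 \<and>
            (\<forall>R\<ge>1. trig_poly_degree_le (k R) (P R)) \<and>
            ((\<lambda>R. real (k R) / R\<^sup>2) \<longlongrightarrow> 0) at_top \<and>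
            (\<forall>\<^sub>F R in at_top.
               Lp_norm 2 (restrict_space lborel unit_square) (\<lambda>x. complex_of_real (g R x) - P R x)
                 \<le> ennreal \<eta> * Lp_norm 2 (restrict_space lborel unit_square) (g R)))"
proof
  assume "\<exists>(\<eta>::real) (k :: real \<Rightarrow> nat) (P :: real \<Rightarrow> plane \<Rightarrow> complex).
            0 < \<eta> \<and> \<eta> < 1 \<and>
            (\<forall>R\<ge>1. trig_poly_degree_le (k R) (P R)) \<and>
            ((\<lambda>R. real (k R) / R\<^sup>2) \<longlongrightarrow> 0) at_top \<and>
            (\<forall>\<^sub>F R in at_top.
               Lp_norm 2 (restrict_space lborel unit_square) (\<lambda>x. complex_of_real (g R x) - P R x)
                 \<le> ennreal \<eta> * Lp_norm 2 (restrict_space lborel unit_square) (g R))"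
  then obtain \<eta> :: real and k :: "real \<Rightarrow> nat" and P :: "real \<Rightarrow> plane \<Rightarrow> complex" where
    \<eta>: "0 < \<eta>" "\<eta> < 1" and P: "\<And>R. R \<ge> 1 \<Longrightarrow> trig_poly_degree_le (k R) (P R)"
    and k: "((\<lambda>R. real (k R) / R\<^sup>2) \<longlongrightarrow> 0) at_top"
    and approx: "\<forall>\<^sub>F R in at_top.
               Lp_norm 2 (restrict_space lborel unit_square) (\<lambda>x. complex_of_real (g R x) - P R x)
                 \<le> ennreal \<eta> * Lp_norm 2 (restrict_space lborel unit_square) (g R)"
    by blast
  have prob: "prob_space \<mu>" and sets: "sets \<mu> = sets borel" and AE: "AE x in \<mu>. x \<in> unit_square"
    using mu by (auto simp: Laba_Wang_measure_def)
  obtain K where K: "K > 0" "\<And>x. \<psi> x \<noteq> 0 \<Longrightarrow> norm x < K"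
    using psi(1) by (rule test_function_support_bounded) blast
  obtain B where B: "\<And>x. \<bar>\<psi> x\<bar> \<le> B"
    using psi(1) by (rule test_function_bounded) blast
  obtain p where p: "\<psi> p > 0"
  proof -
    have "\<psi> \<noteq> (\<lambda>_. 0)" using psi(3) by auto
    then show thesis using that psi(2) by (metis less_le)
  qed
  \<comment> \<open>Failure of convergence to 0 gives a distance \<open>c\<close> that is kept from
    the boundary at arbitrarily large scales, though not necessarily at all large ones.\<close>
  obtain c where c: "c > 0"
    and often: "\<not> (\<forall>\<^sub>F R in at_top. infdist (z R) (frontier unit_square) < c)"
    using centre_not_to_boundary by (auto simp: tendsto_iff infdist_nonneg)
  \<comment> \<open>With this choice \<open>(1 + t) * \<eta>\<^sup>2\<close> is the midpoint of
    \<open>\<eta>\<^sup>2\<close> and 1, which leaves room for the vanishing second term of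
    \<open>F\<close>.\<close>
  define t where "t = (1 - \<eta>\<^sup>2) / (2 * \<eta>\<^sup>2)"
  have \<eta>2: "\<eta>\<^sup>2 < 1" using \<eta> by (simp add: power_less_one_iff abs_square_less_1)
  have t: "t > 0" using \<eta> \<eta>2 by (simp add: t_def)
  define F where "F R = (1 + t) * \<eta>\<^sup>2 + (1 + 1 / t) * (4 * (2 * (4 / c)\<^sup>2 * (K + 1)\<^sup>2 * (real (k R) / R\<^sup>2)))" for R
  have "(F \<longlongrightarrow> (1 + t) * \<eta>\<^sup>2 + (1 + 1 / t) * (4 * (2 * (4 / c)\<^sup>2 * (K + 1)\<^sup>2 * 0))) at_top"
    unfolding F_def by (intro tendsto_intros k)
  moreover have "(1 + t) * \<eta>\<^sup>2 + (1 + 1 / t) * (4 * (2 * (4 / c)\<^sup>2 * (K + 1)\<^sup>2 * 0)) < 1"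
    using \<eta> \<eta>2 by (simp add: t_def field_simps)
  ultimately have small: "\<forall>\<^sub>F R in at_top. F R < 1" by (rule order_tendstoD)
  \<comment> \<open>A large scale with a centre at distance at least \<open>c\<close> would force
    \<open>1 \<le> F R\<close>, so all large scales have centres near the boundary, contrary to
    \<open>often\<close>. The threshold \<open>2 * (K + 1) / c\<close> makes the ball carrying
    \<open>g R\<close> have radius at most \<open>c / 2\<close>.\<close>
  have "\<forall>\<^sub>F R in at_top. infdist (z R) (frontier unit_square) < c"
    using approx small eventually_ge_at_top[of 1] eventually_ge_at_top[of "2 * (K + 1) / c"]
  proof eventually_elim
    case (elim R)
    show ?case
    proof (rule ccontr)
      assume far: "\<not> infdist (z R) (frontier unit_square) < c"
      have "z R \<in> unit_square"
        using AE_closed_imp_topological_support_subset[OF AE closed_cbox sets] centre[OF elim(3)] by blast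
      with far have ball: "ball (z R) c \<subseteq> unit_square"
        by (intro ball_subset_if_infdist_frontier) auto
      have R: "R > 0" using elim by simp
      have scale: "(K + 1) / R \<le> c / 2"
        using elim(4) c R by (simp add: field_simps)
      have "1 \<le> F R"
        unfolding F_def
        by (rule sparse_approximation_necessary_condition[OF prob sets
              test_function_continuous[OF psi(1)] psi(2) K(2) B p centre[OF elim(3)] R c ball scale
              K(1) P[OF elim(3)] \<eta> t elim(1)[unfolded g[OF elim(3)] f[OF elim(3)]]])
      with elim(2) show False by simp
    qed
  qed
  with often show False by simp
qed

end
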